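(* Let $\{(z^k,y^k)\}_{k\in\mathbb N}$ be a sequence generated by FLAG with $\sigma=0$ and $t_k=1$ for all $k\in\mathbb N$ (see the context). Then, for any optimal solution $z^*$ of problem (P) and every integer $N\ge1$, the ergodic sequence $\bar z^N=N^{-1}\sum_{k=0}^{N-1}z^{k+1}$ satisfies $$\Psi(\bar z^N)-\Psi(z^* )\le\frac{B_{\rho,c}(z^* )}{2N},\qquad \|\mathcal A\bar z^N-b\|\le\frac{B_{\rho,c}(z^* )}{cN},$$ where $B_{\rho,c}(z^* ):=2\left(\|z^*-z^0\|_P^2+\frac{1}{\mu\rho}(\|y^0\|+c)^2\right)$.
   Context: **Problem.** Let $\Psi:\mathbb R^n\to(-\infty,+\infty]$ be proper, lower semicontinuous and convex (this is the case $\sigma=0$), $\mathcal A:\mathbb R^n\to\mathbb R^m$ linear, $b\in\mathbb R^m$. Problem (P) is $\min\{\Psi(x):\mathcal A x=b,\ x\in\mathbb R^n\}$, with feasible set $\mathcal F=\{x\in\mathbb R^n:\mathcal A x=b\}$. The Lagrangian is $\mathcal L(x,y)=\Psi(x)+\langle y,\mathcal A x-b\rangle$ and, for $\rho\geq 0$, the augmented Lagrangian is $\mathcal L_\rho(x,y)=\mathcal L(x,y)+\frac{\rho}{2}\|\mathcal A x-b\|^2$. Standing assumption: $\mathcal L$ has a saddle point, i.e. there is $(x^*,y^* )$ with $\mathcal L(x^*,y)\le\mathcal L(x^*,y^* )\le\mathcal L(x,y^* )$ for all $x\in\mathbb R^n,y\in\mathbb R^m$. The dual problem is to maximize $\inf_x\mathcal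 L(x,y)$ over $y\in\mathbb R^m$. The constant $c>0$ is such that $c\ge 2\|y^*\|$, where $y^*$ is an optimal solution of the dual problem. **Notation.** $\mathbb S_+^n$ is the set of $n\times n$ symmetric positive semidefinite matrices; for $P\in\mathbb S_+^n$, $\|u\|_P=\sqrt{\langle u,Pu\rangle}$ and $\Delta_P(u,v,w)=\frac12(\|u-v\|_P^2-\|u-w\|_P^2)$. **Nice primal algorithmic map (case $\sigma=0$, $t=1$).** Given $\rho>0$, a (possibly set-valued) map $\mathrm{Prim}_1$ on $\mathbb R^n\times\mathbb R^m$ with values in $\mathbb R^n$ is nice with $\delta\in(0,1]$ and $P,Q\in\mathbb S_+^n$ if for all $(z,\lambda)$, all $z^+\in\mathrm{Prim}_1(z,\lambda)$ and all $\xi\in\mathcal F$, $$\mathcal L_{\rho}(z^+,\lambda)-\mathcal L_{\rho}(\xi,\lambda)\le\Delta_P(\xi,z,z^+)-\frac{1}{2}\|z^+-z\|_Q^2-\frac{\delta\rho}{2}\|\mathcal A z^+-b\|^2.$$ **FLAG with $\sigma=0$, $t_k\equiv1$.** Input: a nice map $\mathrm{Prim}_1$ with $\delta,P,Q$. Choose $\mu\in(0,1+\delta]$, $\rho>0$, any $(z^0,y^0)\in\mathbb R^n\times\mathbb R^m$, and for $k\ge0$ $$z^{k+1}\in\mathrm{Prim}_{1}(z^k,y^k),\quad y^{k+1}=y^k+\mu\rho(\mathcal A z^{k+1}-b).$$ *)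

theory Defs
  imports "HOL-Analysis.Analysis"
begin

text \<open>
  Extended-valued objectives have type \<^typ>\<open>ereal\<close>; the value \<open>-\<infinity>\<close> is excluded by properness.
\<close>

definition proper_fun :: "('a \<Rightarrow> ereal) \<Rightarrow> bool" where
  "proper_fun f \<longleftrightarrow> (\<forall>x. f x \<noteq> -\<infinity>) \<and> (\<exists>x. f x \<noteq> \<infinity>)"

definition lsc_fun :: "('a::topological_space \<Rightarrow> ereal) \<Rightarrow> bool" where
  "lsc_fun f \<longleftrightarrow> (\<forall>x. f x \<le> Liminf (at x) f)"

text \<open>
  The library's \<^const>\<open>convex_on\<close> is for real-valued functions only. At \<open>t = 0\<close> and \<open>t = 1\<close> the
  convention \<open>0 * \<infinity> = 0\<close> of \<^typ>\<open>ereal\<close> makes the inequality trivial, as intended.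
\<close>

definition convex_fun :: "('a::real_vector \<Rightarrow> ereal) \<Rightarrow> bool" where
  "convex_fun f \<longleftrightarrow>
     (\<forall>x y. \<forall>t\<in>{0..1}. f ((1 - t) *\<^sub>R x + t *\<^sub>R y) \<le> ereal (1 - t) * f x + ereal t * f y)"

definition feasible :: "(real^'n \<Rightarrow> real^'m) \<Rightarrow> real^'m \<Rightarrow> (real^'n) set" where
  "feasible A b = {x. A x = b}"

definition optimal_primal ::
    "(real^'n \<Rightarrow> ereal) \<Rightarrow> (real^'n \<Rightarrow> real^'m) \<Rightarrow> real^'m \<Rightarrow> real^'n \<Rightarrow> bool" where
  "optimal_primal \<Psi> A b z \<longleftrightarrow> z \<in> feasible A b \<and> (\<forall>x\<in>feasible A b. \<Psi> z \<le> \<Psi> x)"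

definition lagrangian ::
    "(real^'n \<Rightarrow> ereal) \<Rightarrow> (real^'n \<Rightarrow> real^'m) \<Rightarrow> real^'m \<Rightarrow> real^'n \<Rightarrow> real^'m \<Rightarrow> ereal" where
  "lagrangian \<Psi> A b x y = \<Psi> x + ereal (y \<bullet> (A x - b))"

definition aug_lagrangian ::
    "(real^'n \<Rightarrow> ereal) \<Rightarrow> (real^'n \<Rightarrow> real^'m) \<Rightarrow> real^'m \<Rightarrow> real \<Rightarrow> real^'n \<Rightarrow> real^'m \<Rightarrow> ereal" where
  "aug_lagrangian \<Psi> A b \<rho> x y = lagrangian \<Psi> A b x y + ereal (\<rho> / 2 * (norm (A x - b))\<^sup>2)"

definition saddle_point ::
    "(real^'n \<Rightarrow> ereal) \<Rightarrow> (real^'n \<Rightarrow> real^'m) \<Rightarrow> real^'m \<Rightarrow> real^'n \<Rightarrow> real^'m \<Rightarrow> bool" where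
  "saddle_point \<Psi> A b xs ys \<longleftrightarrow>
     (\<forall>x y. lagrangian \<Psi> A b xs y \<le> lagrangian \<Psi> A b xs ys \<and>
            lagrangian \<Psi> A b xs ys \<le> lagrangian \<Psi> A b x ys)"

definition dual_fun ::
    "(real^'n \<Rightarrow> ereal) \<Rightarrow> (real^'n \<Rightarrow> real^'m) \<Rightarrow> real^'m \<Rightarrow> real^'m \<Rightarrow> ereal" where
  "dual_fun \<Psi> A b y = (INF x. lagrangian \<Psi> A b x y)"

definition optimal_dual ::
    "(real^'n \<Rightarrow> ereal) \<Rightarrow> (real^'n \<Rightarrow> real^'m) \<Rightarrow> real^'m \<Rightarrow> real^'m \<Rightarrow> bool" where
  "optimal_dual \<Psi> A b ys \<longleftrightarrow> (\<forall>y. dual_fun \<Psi> A b y \<le> dual_fun \<Psi> A b ys)"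

definition psd :: "real^'n^'n \<Rightarrow> bool" where
  "psd P \<longleftrightarrow> transpose P = P \<and> (\<forall>u. 0 \<le> u \<bullet> (P *v u))"

definition mnorm :: "real^'n^'n \<Rightarrow> real^'n \<Rightarrow> real" where
  "mnorm P u = sqrt (u \<bullet> (P *v u))"

definition Delta :: "real^'n^'n \<Rightarrow> real^'n \<Rightarrow> real^'n \<Rightarrow> real^'n \<Rightarrow> real" where
  "Delta P u v w = 1 / 2 * ((mnorm P (u - v))\<^sup>2 - (mnorm P (u - w))\<^sup>2)"

text \<open>
  Set-valued maps are modelled as functions into sets. In \<^typ>\<open>ereal\<close>, \<open>\<infinity> - \<infinity> = \<infinity>\<close>, but under the
  saddle point assumption this case imposes nothing extra: some feasible \<open>\<xi>\<close> has \<open>\<Psi> \<xi> < \<infinity>\<close>, and the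
  inequality at this \<open>\<xi>\<close> already forces \<open>\<Psi> z' < \<infinity>\<close> for every \<open>z' \<in> Prim z \<lambda>\<close>.
\<close>

definition nice_map ::
    "(real^'n \<Rightarrow> ereal) \<Rightarrow> (real^'n \<Rightarrow> real^'m) \<Rightarrow> real^'m \<Rightarrow> real \<Rightarrow>
     (real^'n \<Rightarrow> real^'m \<Rightarrow> (real^'n) set) \<Rightarrow> real \<Rightarrow> real^'n^'n \<Rightarrow> real^'n^'n \<Rightarrow> bool" where
  "nice_map \<Psi> A b \<rho> Prim \<delta> P Q \<longleftrightarrow>
     \<delta> \<in> {0<..1} \<and> psd P \<and> psd Q \<and>
     (\<forall>z y. \<forall>z'\<in>Prim z y. \<forall>\<xi>\<in>feasible A b.
        aug_lagrangian \<Psi> A b \<rho> z' y - aug_lagrangian \<Psi> A b \<rho> \<xi> y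
          \<le> ereal (Delta P \<xi> z z' - 1 / 2 * (mnorm Q (z' - z))\<^sup>2
                     - \<delta> * \<rho> / 2 * (norm (A z' - b))\<^sup>2))"

definition flag_sequence ::
    "(real^'n \<Rightarrow> real^'m) \<Rightarrow> real^'m \<Rightarrow> (real^'n \<Rightarrow> real^'m \<Rightarrow> (real^'n) set) \<Rightarrow> real \<Rightarrow> real \<Rightarrow>
     (nat \<Rightarrow> real^'n) \<Rightarrow> (nat \<Rightarrow> real^'m) \<Rightarrow> bool" where
  "flag_sequence A b Prim \<mu> \<rho> z y \<longleftrightarrow>
     (\<forall>k. z (Suc k) \<in> Prim (z k) (y k) \<and>
          y (Suc k) = y k + (\<mu> * \<rho>) *\<^sub>R (A (z (Suc k)) - b))"

definition ergodic :: "(nat \<Rightarrow> 'a::real_vector) \<Rightarrow> nat \<Rightarrow> 'a" where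
  "ergodic z N = inverse (real N) *\<^sub>R (\<Sum>k<N. z (Suc k))"

definition B_const ::
    "real^'n^'n \<Rightarrow> real \<Rightarrow> real \<Rightarrow> real \<Rightarrow> real^'n \<Rightarrow> real^'m \<Rightarrow> real^'n \<Rightarrow> real" where
  "B_const P \<mu> \<rho> c z0 y0 zs =
     2 * ((mnorm P (zs - z0))\<^sup>2 + 1 / (\<mu> * \<rho>) * (norm y0 + c)\<^sup>2)"

end

theory Submission
  imports Defs
begin

text \<open>
  The proof tests the iteration against an arbitrary multiplier \<open>\<eta>\<close>. Niceness of the primal map at
  the feasible point \<open>z\<^sup>*\<close>, combined with the identity for \<open>\<parallel>\<eta> - y\<parallel>\<^sup>2\<close> along the dual update, bounds
  \<open>\<Psi> (z\<^sup>k\<^sup>+\<^sup>1) - \<Psi> z\<^sup>* + \<eta> \<bullet> (A z\<^sup>k\<^sup>+\<^sup>1 - b)\<close> by the decrease in step \<open>k\<close> of the potential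
  \<open>\<parallel>z\<^sup>* - z\<^sup>k\<parallel>\<^sub>P\<^sup>2 / 2 + \<parallel>\<eta> - y\<^sup>k\<parallel>\<^sup>2 / (2\<mu>\<rho>)\<close> (lemma \<open>flag_step\<close>). The quadratic terms in the residual cancel
  up to a term of the right sign because \<open>\<mu> \<le> 1 + \<delta>\<close>. The bound telescopes, and Jensen's inequality
  (lemma \<open>convex_fun_average\<close>) turns the average of the left-hand sides into the value at the
  ergodic point.

  The multiplier that is aligned with the ergodic residual and has length \<open>c\<close> replaces
  the inner product by \<open>c \<parallel>A \<zeta> - b\<parallel>\<close>, where \<open>\<zeta>\<close> is the ergodic point. Strong duality
  (lemma \<open>dual_optimal_lower_bound\<close>) shows that the objective gap cannot be below
  \<open>- \<parallel>y\<^sup>*\<parallel> \<parallel>A \<zeta> - b\<parallel> \<ge> - (c / 2) \<parallel>A \<zeta> - b\<parallel>\<close>, so half of the penalty survives and bounds the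
  residual. The objective bound is the same inequality with the nonnegative penalty dropped.
\<close>

text \<open>
  In terms of the epigraph, which is an ordinary convex set, Jensen's inequality needs no arithmetic
  with infinite values.
\<close>

lemma convex_fun_epigraph:
  fixes f :: "'a::real_vector \<Rightarrow> ereal"
  assumes "convex_fun f"
  shows "convex {p. f (fst p) \<le> ereal (snd p)}"
proof (rule convexI)
  fix p q :: "'a \<times> real" and u v :: real
  assume p: "p \<in> {p. f (fst p) \<le> ereal (snd p)}" and q: "q \<in> {p. f (fst p) \<le> ereal (snd p)}"
    and u: "0 \<le> u" and v: "0 \<le> v" and uv: "u + v = 1"
  have u_eq: "u = 1 - v" using uv by simp
  have "f (u *\<^sub>R fst p + v *\<^sub>R fst q) \<le> ereal u * f (fst p) + ereal v * f (fst q)"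
    using assms u v unfolding convex_fun_def u_eq by simp
  also have "\<dots> \<le> ereal u * ereal (snd p) + ereal v * ereal (snd q)"
    using p q u v by (intro add_mono ereal_mult_left_mono) auto
  finally show "u *\<^sub>R p + v *\<^sub>R q \<in> {p. f (fst p) \<le> ereal (snd p)}" by simp
qed

lemma convex_fun_average:
  fixes f :: "'a::real_vector \<Rightarrow> ereal"
  assumes f: "convex_fun f" and N: "N \<ge> 1"
    and bound: "\<And>k. k < N \<Longrightarrow> f (x k) \<le> ereal (h k)"
  shows "f (inverse (real N) *\<^sub>R (\<Sum>k<N. x k)) \<le> ereal (inverse (real N) * (\<Sum>k<N. h k))"
proof -
  have "(\<Sum>k<N. inverse (real N) *\<^sub>R (x k, h k)) \<in> {p. f (fst p) \<le> ereal (snd p)}"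
    by (rule convex_sum[OF _ convex_fun_epigraph[OF f]]) (use N bound in auto)
  moreover have "(\<Sum>k<N. inverse (real N) *\<^sub>R (x k, h k))
      = (inverse (real N) *\<^sub>R (\<Sum>k<N. x k), inverse (real N) * (\<Sum>k<N. h k))"
    by (simp add: prod_eq_iff fst_sum snd_sum scaleR_sum_right sum_distrib_left)
  ultimately show ?thesis by simp
qed

text \<open>
  At a saddle point the multiplier cannot be improved, even in the direction of the residual
  itself; hence the residual vanishes. The value is finite since the saddle point minimises the Lagrangian, which is not
  identically \<open>\<infinity>\<close>.
\<close>

lemma saddle_point_feasible:
  assumes "proper_fun \<Psi>" and sp: "saddle_point \<Psi> A b xs ys"
  shows "xs \<in> feasible A b" and "\<bar>\<Psi> xs\<bar> \<noteq> \<infinity>"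
proof -
  obtain x0 where x0: "\<Psi> x0 \<noteq> \<infinity>" using assms(1) by (auto simp: proper_fun_def)
  have minf: "\<And>x. \<Psi> x \<noteq> -\<infinity>" using assms(1) by (auto simp: proper_fun_def)
  have "\<Psi> xs + ereal (ys \<bullet> (A xs - b)) \<le> \<Psi> x0 + ereal (ys \<bullet> (A x0 - b))"
    using sp by (auto simp: saddle_point_def lagrangian_def)
  then have "\<Psi> xs \<noteq> \<infinity>" using x0 by auto
  then show fin: "\<bar>\<Psi> xs\<bar> \<noteq> \<infinity>" using minf[of xs] by auto
  have "\<Psi> xs + ereal ((ys + (A xs - b)) \<bullet> (A xs - b)) \<le> \<Psi> xs + ereal (ys \<bullet> (A xs - b))"
    using sp unfolding saddle_point_def lagrangian_def by blast
  then have "(A xs - b) \<bullet> (A xs - b) \<le> 0"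
    using fin by (cases "\<Psi> xs") (auto simp: inner_add_left)
  then have "A xs - b = 0" by (metis inner_eq_zero_iff inner_ge_zero order_antisym)
  then show "xs \<in> feasible A b" by (simp add: feasible_def)
qed

lemma optimal_primal_finite:
  assumes "proper_fun \<Psi>" "saddle_point \<Psi> A b xs ys" "optimal_primal \<Psi> A b zstar"
  shows "\<bar>\<Psi> zstar\<bar> \<noteq> \<infinity>"
proof -
  have "\<Psi> zstar \<le> \<Psi> xs" "\<Psi> zstar \<noteq> -\<infinity>"
    using assms saddle_point_feasible(1)[OF assms(1,2)]
    by (auto simp: optimal_primal_def proper_fun_def)
  then show ?thesis using saddle_point_feasible(2)[OF assms(1,2)] by auto
qed

text \<open>
  This is strong duality. The multiplier of the saddle point attains the primal value in the dual
  problem, so every dual optimal multiplier attains at least that value.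
\<close>

lemma dual_optimal_lower_bound:
  assumes "proper_fun \<Psi>" and sp: "saddle_point \<Psi> A b xs ys"
    and "optimal_primal \<Psi> A b zstar" and "optimal_dual \<Psi> A b ystar"
  shows "\<Psi> zstar \<le> \<Psi> x + ereal (ystar \<bullet> (A x - b))"
proof -
  have feas: "xs \<in> feasible A b" by (rule saddle_point_feasible[OF assms(1) sp])
  then have "\<Psi> zstar \<le> \<Psi> xs" using assms(3) by (auto simp: optimal_primal_def)
  also have "\<Psi> xs = lagrangian \<Psi> A b xs ys"
    using feas by (simp add: lagrangian_def feasible_def)
  also have "\<dots> \<le> dual_fun \<Psi> A b ys"
    using sp unfolding dual_fun_def saddle_point_def by (auto intro: INF_greatest)
  also have "\<dots> \<le> dual_fun \<Psi> A b ystar" using assms(4) by (simp add: optimal_dual_def)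
  also have "\<dots> \<le> lagrangian \<Psi> A b x ystar" unfolding dual_fun_def by (rule INF_lower) simp
  finally show ?thesis by (simp add: lagrangian_def)
qed

text \<open>
  With \<open>r\<close> the residual of the new point, the dual update gives
  \<open>(\<parallel>\<eta> - y\<parallel>\<^sup>2 - \<parallel>\<eta> - y'\<parallel>\<^sup>2) / (2\<mu>\<rho>) = (\<eta> - y) \<bullet> r - \<mu>\<rho> / 2 \<parallel>r\<parallel>\<^sup>2\<close>, whereas niceness bounds
  \<open>\<Psi> z' - \<Psi> \<xi> + \<eta> \<bullet> r\<close> from above by \<open>\<Delta>\<^sub>P + (\<eta> - y) \<bullet> r - (1 + \<delta>)\<rho> / 2 \<parallel>r\<parallel>\<^sup>2\<close>. Since \<open>\<mu> \<le> 1 + \<delta>\<close>, the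
  latter is at most the former plus \<open>\<Delta>\<^sub>P\<close>.
\<close>

lemma flag_step:
  fixes \<rho> \<mu> :: real and \<eta> :: "real^'m"
  assumes nice: "nice_map \<Psi> A b \<rho> Prim \<delta> P Q" and z': "z' \<in> Prim z y"
    and y': "y' = y + (\<mu> * \<rho>) *\<^sub>R (A z' - b)"
    and "\<rho> > 0" and mu: "\<mu> \<in> {0<..1 + \<delta>}"
    and \<xi>: "\<xi> \<in> feasible A b" and p: "\<Psi> \<xi> = ereal p"
  shows "\<Psi> z' \<le> ereal (p - \<eta> \<bullet> (A z' - b)
      + (((mnorm P (\<xi> - z))\<^sup>2 + 1 / (\<mu> * \<rho>) * (norm (\<eta> - y))\<^sup>2)
       - ((mnorm P (\<xi> - z'))\<^sup>2 + 1 / (\<mu> * \<rho>) * (norm (\<eta> - y'))\<^sup>2)) / 2)"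
proof -
  define r where "r = A z' - b"
  have \<xi>0: "A \<xi> = b" using \<xi> by (simp add: feasible_def)
  have "\<Psi> z' + ereal (y \<bullet> r) + ereal (\<rho> / 2 * (norm r)\<^sup>2) - ereal p
      \<le> ereal (Delta P \<xi> z z' - 1 / 2 * (mnorm Q (z' - z))\<^sup>2 - \<delta> * \<rho> / 2 * (norm r)\<^sup>2)"
    using nice z' \<xi> unfolding nice_map_def aug_lagrangian_def lagrangian_def r_def
    by (fastforce simp: \<xi>0 p)
  then have main: "\<Psi> z' \<le> ereal (p + Delta P \<xi> z z' - 1 / 2 * (mnorm Q (z' - z))\<^sup>2
      - \<delta> * \<rho> / 2 * (norm r)\<^sup>2 - y \<bullet> r - \<rho> / 2 * (norm r)\<^sup>2)"
    by (cases "\<Psi> z'") auto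
  have pos: "\<mu> * \<rho> > 0" using mu \<open>\<rho> > 0\<close> by simp
  have "(norm (\<eta> - y'))\<^sup>2 = (norm (\<eta> - y))\<^sup>2 - 2 * (\<mu> * \<rho>) * ((\<eta> - y) \<bullet> r) + (\<mu> * \<rho>)\<^sup>2 * (norm r)\<^sup>2"
    unfolding y' r_def[symmetric] power2_norm_eq_inner
    by (simp add: inner_diff_left inner_diff_right inner_add_left inner_add_right inner_commute
        power2_eq_square algebra_simps)
  then have "(norm (\<eta> - y))\<^sup>2 - (norm (\<eta> - y'))\<^sup>2
      = (\<mu> * \<rho>) * (2 * ((\<eta> - y) \<bullet> r) - \<mu> * \<rho> * (norm r)\<^sup>2)"
    by (simp add: algebra_simps power2_eq_square)
  then have "((norm (\<eta> - y))\<^sup>2 - (norm (\<eta> - y'))\<^sup>2) / (\<mu> * \<rho>)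
      = 2 * ((\<eta> - y) \<bullet> r) - \<mu> * \<rho> * (norm r)\<^sup>2"
    using pos by (metis less_irrefl nonzero_mult_div_cancel_left)
  then have dual: "1 / (\<mu> * \<rho>) * (norm (\<eta> - y))\<^sup>2 - 1 / (\<mu> * \<rho>) * (norm (\<eta> - y'))\<^sup>2
      = 2 * ((\<eta> - y) \<bullet> r) - \<mu> * \<rho> * (norm r)\<^sup>2"
    by (simp add: diff_divide_distrib)
  have "\<mu> * \<rho> * (norm r)\<^sup>2 \<le> (1 + \<delta>) * \<rho> * (norm r)\<^sup>2"
    using mu \<open>\<rho> > 0\<close> by (intro mult_right_mono) auto
  then have quad: "\<mu> * \<rho> * (norm r)\<^sup>2 \<le> \<rho> * (norm r)\<^sup>2 + \<delta> * \<rho> * (norm r)\<^sup>2"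
    by (simp add: algebra_simps)
  have Q: "(mnorm Q (z' - z))\<^sup>2 \<ge> 0" by simp
  show ?thesis
    using dual quad Q unfolding Delta_def r_def[symmetric] inner_diff_left
    by (intro order_trans[OF main[unfolded Delta_def]], unfold ereal_less_eq) argo
qed

lemma residual_ergodic:
  assumes "linear A" "N \<ge> 1"
  shows "A (ergodic z N) - b = inverse (real N) *\<^sub>R (\<Sum>k<N. A (z (Suc k)) - b)"
  using assms
  by (simp add: ergodic_def linear_scale linear_sum sum_subtractf scaleR_diff_right sum_constant_scaleR)

text \<open>
  The multiplier \<open>\<eta>\<close> stays free so that it can be chosen after the ergodic residual is known. The
  per-step decreases telescope, and the potential left after \<open>N\<close> steps is nonnegative.
\<close>

lemma flag_ergodic_gap:
  fixes \<rho> \<mu> :: real and \<eta> :: "real^'m"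
  assumes conv: "convex_fun \<Psi>" and lin: "linear A"
    and nice: "nice_map \<Psi> A b \<rho> Prim \<delta> P Q"
    and flag: "flag_sequence A b Prim \<mu> \<rho> z y"
    and rho: "\<rho> > 0" and mu: "\<mu> \<in> {0<..1 + \<delta>}"
    and \<xi>: "\<xi> \<in> feasible A b" and p: "\<Psi> \<xi> = ereal p" and N: "N \<ge> 1"
  shows "\<Psi> (ergodic z N) \<le> ereal (p - \<eta> \<bullet> (A (ergodic z N) - b)
      + ((mnorm P (\<xi> - z 0))\<^sup>2 + 1 / (\<mu> * \<rho>) * (norm (\<eta> - y 0))\<^sup>2) / (2 * real N))"
proof -
  define V where "V k = (mnorm P (\<xi> - z k))\<^sup>2 + 1 / (\<mu> * \<rho>) * (norm (\<eta> - y k))\<^sup>2" for k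
  define h where "h k = p - \<eta> \<bullet> (A (z (Suc k)) - b) + (V k - V (Suc k)) / 2" for k
  have "\<Psi> (z (Suc k)) \<le> ereal (h k)" for k
    unfolding h_def V_def
    by (rule flag_step[OF nice _ _ rho mu \<xi> p]) (use flag in \<open>auto simp: flag_sequence_def\<close>)
  then have jensen: "\<Psi> (ergodic z N) \<le> ereal (inverse (real N) * (\<Sum>k<N. h k))"
    unfolding ergodic_def by (intro convex_fun_average conv N)
  have "(\<Sum>k<N. h k) = real N * p - \<eta> \<bullet> (\<Sum>k<N. A (z (Suc k)) - b) + (\<Sum>k<N. V k - V (Suc k)) / 2"
    unfolding h_def inner_sum_right
    by (simp add: sum.distrib sum_subtractf sum_divide_distrib diff_divide_distrib)
  also have "(\<Sum>k<N. V k - V (Suc k)) = V 0 - V N" by (rule sum_lessThan_telescope')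
  finally have sum_h: "(\<Sum>k<N. h k)
      = real N * p - \<eta> \<bullet> (\<Sum>k<N. A (z (Suc k)) - b) + (V 0 - V N) / 2" .
  have "inverse (real N) * (\<Sum>k<N. h k)
      = p - \<eta> \<bullet> (A (ergodic z N) - b) + (V 0 - V N) / (2 * real N)"
    using N unfolding sum_h residual_ergodic[OF lin N]
    by (simp add: field_simps)
  moreover have "V N \<ge> 0" using rho mu by (simp add: V_def)
  then have "(V 0 - V N) / (2 * real N) \<le> V 0 / (2 * real N)"
    by (intro divide_right_mono) auto
  ultimately show ?thesis
    using order_trans[OF jensen] by (simp add: V_def)
qed

theorem corollary4p2:
  fixes \<Psi> :: "real^'n \<Rightarrow> ereal"
    and A :: "real^'n \<Rightarrow> real^'m"
    and b :: "real^'m"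
    and Prim :: "real^'n \<Rightarrow> real^'m \<Rightarrow> (real^'n) set"
    and P Q :: "real^'n^'n"
    and \<delta> \<mu> \<rho> c :: real
    and z :: "nat \<Rightarrow> real^'n"
    and y :: "nat \<Rightarrow> real^'m"
    and ystar :: "real^'m"
    and zstar :: "real^'n"
    and N :: nat
  assumes "proper_fun \<Psi>" and "lsc_fun \<Psi>" and "convex_fun \<Psi>"
    and "linear A"
    and "\<exists>xs ys. saddle_point \<Psi> A b xs ys"
    and "optimal_dual \<Psi> A b ystar"
    and "c > 0" and "c \<ge> 2 * norm ystar"
    and "\<rho> > 0"
    and "nice_map \<Psi> A b \<rho> Prim \<delta> P Q"
    and "\<mu> \<in> {0<..1 + \<delta>}"
    and "flag_sequence A b Prim \<mu> \<rho> z y"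
    and "optimal_primal \<Psi> A b zstar"
    and "N \<ge> 1"
  shows "\<Psi> (ergodic z N) - \<Psi> zstar
           \<le> ereal (B_const P \<mu> \<rho> c (z 0) (y 0) zstar / (2 * real N))
         \<and> norm (A (ergodic z N) - b)
           \<le> B_const P \<mu> \<rho> c (z 0) (y 0) zstar / (c * real N)"
proof -
  obtain xs ys where sp: "saddle_point \<Psi> A b xs ys" using assms(5) by blast
  obtain p where p: "\<Psi> zstar = ereal p"
    using optimal_primal_finite[OF assms(1) sp assms(13)] by auto
  have feas: "zstar \<in> feasible A b" using assms(13) by (simp add: optimal_primal_def)
  define r where "r = A (ergodic z N) - b"
  define B where "B = B_const P \<mu> \<rho> c (z 0) (y 0) zstar"
  \<comment> \<open>For a zero residual this is \<open>0\<close>, as \<open>sgn 0 = 0\<close>, and the estimates below still hold.\<close>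
  define \<eta> where "\<eta> = c *\<^sub>R sgn r"
  have eta_r: "\<eta> \<bullet> r = c * norm r"
    by (cases "r = 0") (simp_all add: \<eta>_def sgn_div_norm dot_square_norm power2_eq_square)
  have "norm \<eta> \<le> c" using assms(7) by (simp add: \<eta>_def norm_sgn)
  then have "norm (\<eta> - y 0) \<le> norm (y 0) + c" using norm_triangle_ineq4[of \<eta> "y 0"] by linarith
  then have "1 / (\<mu> * \<rho>) * (norm (\<eta> - y 0))\<^sup>2 \<le> 1 / (\<mu> * \<rho>) * (norm (y 0) + c)\<^sup>2"
    using assms(9,11) by (intro mult_left_mono power_mono) auto
  moreover have "B / 2 = (mnorm P (zstar - z 0))\<^sup>2 + 1 / (\<mu> * \<rho>) * (norm (y 0) + c)\<^sup>2"
    by (simp add: B_def B_const_def)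
  ultimately have "(mnorm P (zstar - z 0))\<^sup>2 + 1 / (\<mu> * \<rho>) * (norm (\<eta> - y 0))\<^sup>2 \<le> B / 2"
    by linarith
  then have "((mnorm P (zstar - z 0))\<^sup>2 + 1 / (\<mu> * \<rho>) * (norm (\<eta> - y 0))\<^sup>2) / (2 * real N)
      \<le> (B / 2) / (2 * real N)"
    by (intro divide_right_mono) auto
  then have up: "\<Psi> (ergodic z N) \<le> ereal (p - c * norm r + B / (4 * real N))"
    using order_trans[OF flag_ergodic_gap[OF assms(3,4,10,12,9,11) feas p assms(14), of \<eta>]]
    by (simp add: r_def[symmetric] eta_r)
  have low: "ereal p \<le> \<Psi> (ergodic z N) + ereal (ystar \<bullet> r)"
    using dual_optimal_lower_bound[OF assms(1) sp assms(13,6), of "ergodic z N"] p by (simp add: r_def)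
  obtain q where q: "\<Psi> (ergodic z N) = ereal q"
    using up low by (cases "\<Psi> (ergodic z N)") auto
  have "ystar \<bullet> r \<le> norm ystar * norm r" by (rule norm_cauchy_schwarz)
  also have "\<dots> \<le> c / 2 * norm r" using assms(8) by (intro mult_right_mono) auto
  finally have half: "ystar \<bullet> r \<le> c / 2 * norm r" .
  have cr: "c * norm r \<ge> 0" using assms(7) by simp
  have B0: "B / (4 * real N) \<ge> 0" using assms(9,11) by (simp add: B_def B_const_def)
  have u: "q \<le> p - c * norm r + B / (4 * real N)" and l: "p \<le> q + ystar \<bullet> r"
    using up low q by auto
  have "c * norm r \<le> B / real N" using u l half cr B0 by (simp add: field_simps)
  then have "norm r \<le> B / (c * real N)" using assms(7,14) by (simp add: field_simps)
  moreover have "q - p \<le> B / (2 * real N)" using u cr B0 by (simp add: field_simps)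
  ultimately show ?thesis using p q by (simp add: r_def B_def)
qed

end
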